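(* The regular tetrahedron, the cube, the regular octahedron and the regular icosahedron in $\mathbb{R}^3$ are $m$-point homogeneous polyhedra for every natural number $m\ge 1$, while the regular dodecahedron in $\mathbb{R}^3$ is $2$-point homogeneous but is not $3$-point homogeneous.
   Context: For a metric space $(M,d)$, $\operatorname{Isom}(M)$ is the group of isometries (distance-preserving bijections) of $M$ onto itself. $(M,d)$ is called $m$-point homogeneous, $m\in\mathbb{N}$, if for every $m$-tuples $(A_1,\dots,A_m)$ and $(B_1,\dots,B_m)$ of (not necessarily distinct) elements of $M$ with $d(A_i,A_j)=d(B_i,B_j)$ for all $i,j=1,\dots,m$, there is $f\in \operatorname{Isom}(M)$ with $f(A_i)=B_i$ for $i=1,\dots,m$. A convex polytope in $\mathbb{R}^n$ is called $m$-point homogeneous if its vertex set, with the metric induced by the Euclidean metric of $\mathbb{R}^n$, is $m$-point homogeneous. *)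

theory Defs
  imports "HOL-Analysis.Analysis"
begin

definition Isom :: "'a metric \<Rightarrow> ('a \<Rightarrow> 'a) set" where
  "Isom M = {f. bij_betw f (mspace M) (mspace M) \<and>
                (\<forall>x\<in>mspace M. \<forall>y\<in>mspace M. mdist M (f x) (f y) = mdist M x y)}"

text \<open>An \<open>m\<close>-tuple is given by the values of a function on \<open>{1..m}\<close>; values elsewhere are irrelevant.\<close>

definition point_homogeneous :: "nat \<Rightarrow> 'a metric \<Rightarrow> bool" where
  "point_homogeneous m M \<longleftrightarrow>
     (\<forall>A B. (\<forall>i\<in>{1..m}. A i \<in> mspace M) \<longrightarrow> (\<forall>i\<in>{1..m}. B i \<in> mspace M) \<longrightarrow>
        (\<forall>i\<in>{1..m}. \<forall>j\<in>{1..m}. mdist M (A i) (A j) = mdist M (B i) (B j)) \<longrightarrow>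
        (\<exists>f\<in>Isom M. \<forall>i\<in>{1..m}. f (A i) = B i))"

text \<open>The vertices of a convex polytope are its extreme points.\<close>

definition polytope_vertices :: "'a::euclidean_space set \<Rightarrow> 'a set" where
  "polytope_vertices P = {v. v extreme_point_of P}"

definition point_homogeneous_polytope :: "nat \<Rightarrow> 'a::euclidean_space set \<Rightarrow> bool" where
  "point_homogeneous_polytope m P \<longleftrightarrow>
     polytope P \<and> point_homogeneous m (submetric euclidean_metric (polytope_vertices P))"

text \<open>
  Regular polyhedra are determined up to similarity. Each of the five types is given by the standard
  Cartesian coordinates of the vertices of one representative, and comprises all sets similar to
  that representative, whatever their position, orientation and size.
\<close>

definition similar :: "'a::metric_space set \<Rightarrow> 'a set \<Rightarrow> bool" where
  "similar S T \<longleftrightarrow>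
     (\<exists>f c. 0 < c \<and> bij f \<and> (\<forall>x y. dist (f x) (f y) = c * dist x y) \<and> T = f ` S)"

definition golden_ratio :: real where
  "golden_ratio = (1 + sqrt 5) / 2"

text \<open>The points \<open>(0, \<plusminus>a, \<plusminus>b)\<close> with all choices of signs, and their cyclic permutations.\<close>

definition cyclic_points :: "real \<Rightarrow> real \<Rightarrow> (real^3) set" where
  "cyclic_points a b =
     (\<Union>s\<in>{-a, a}. \<Union>t\<in>{-b, b}. {vector [0, s, t], vector [s, t, 0], vector [t, 0, s]})"

definition regular_tetrahedron :: "(real^3) set \<Rightarrow> bool" where
  "regular_tetrahedron P \<longleftrightarrow>
     similar (convex hull {vector [1, 1, 1], vector [1, -1, -1], vector [-1, 1, -1], vector [-1, -1, 1]}) P"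

definition cube :: "(real^3) set \<Rightarrow> bool" where
  "cube P \<longleftrightarrow> similar (convex hull {x. \<forall>i. x $ i \<in> {-1, 1}}) P"

definition regular_octahedron :: "(real^3) set \<Rightarrow> bool" where
  "regular_octahedron P \<longleftrightarrow> similar (convex hull (\<Union>i. {axis i 1, axis i (-1)})) P"

definition regular_icosahedron :: "(real^3) set \<Rightarrow> bool" where
  "regular_icosahedron P \<longleftrightarrow> similar (convex hull cyclic_points 1 golden_ratio) P"

definition regular_dodecahedron :: "(real^3) set \<Rightarrow> bool" where
  "regular_dodecahedron P \<longleftrightarrow>
     similar (convex hull ({x. \<forall>i. x $ i \<in> {-1, 1}} \<union> cyclic_points (1 / golden_ratio) golden_ratio)) P"

end

theory Submission
  imports Defs
begin

text \<open>A partial isometry of a metric space can be extended one point at a time: if its values at the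
first \<open>m\<close> points are already right, it is enough to move the image \<open>x\<close> of the next point to its
prescribed place \<open>y\<close> by an isometry fixing the \<open>m\<close> values obtained so far, and these are all
equidistant from \<open>x\<close> and \<open>y\<close>.  So a space is \<open>m\<close>-point homogeneous for every \<open>m\<close> as soon as any two
points \<open>x\<close>, \<open>y\<close> are transposable, that is, some isometry takes \<open>x\<close> to \<open>y\<close> and fixes every point
equidistant from them (\<open>point_homogeneous_if_transposable\<close>).

For vertices of a polytope inscribed in a sphere around the origin, the natural candidate is the
reflection in the perpendicular bisector of \<open>x\<close> and \<open>y\<close>.  For the tetrahedron and the octahedron it
always permutes the vertices.  For the cube and the icosahedron it does so unless \<open>y = - x\<close>; but
then no vertex is equidistant from \<open>x\<close> and \<open>y\<close>, because no two vertices are orthogonal, so the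
central symmetry \<open>v \<mapsto> - v\<close> serves.  By symmetry, the icosahedron reduces to one vertex \<open>x\<close> and
to one mirror.

In the dodecahedron some bisectors are not planes of symmetry, and only two points can be
prescribed: its symmetry group is transitive, and the stabilizer of a vertex is transitive on the
vertices at each distance from it.  Three points cannot.  The dodecahedron has an inscribed cube with
vertices \<open>(\<plusminus>1, \<plusminus>1, \<plusminus>1)\<close>, and an isometry that fixes \<open>(1, 1, 1)\<close> and exchanges \<open>(-1, 1, 1)\<close> with
\<open>(1, -1, 1)\<close> must exchange the first two coordinates.  This is a symmetry of the cube, but not of the
dodecahedron: the edge above the face \<open>x\<^sub>3 = 1\<close> of the cube, with end points \<open>(0, \<plusminus>1/\<phi>, \<phi>)\<close> for the
golden ratio \<open>\<phi>\<close>, is parallel to the second axis and not to the first.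

All this is done for one representative of each solid.  A similarity is affine, so it takes convex
hulls to convex hulls and a sphere to a sphere; as points of a sphere are the extreme points of their
convex hull, it takes vertices to vertices and multiplies their distances by a constant
(\<open>point_homogeneous_polytope_similar\<close>).\<close>

section \<open>Homogeneity of metric spaces\<close>

lemma id_in_Isom: "(\<lambda>x. x) \<in> Isom M"
  by (auto simp: Isom_def bij_betw_def)

lemma comp_in_Isom:
  assumes "f \<in> Isom M" "g \<in> Isom M" shows "g \<circ> f \<in> Isom M"
proof -
  have "f x \<in> mspace M" if "x \<in> mspace M" for x
    using assms that by (auto simp: Isom_def bij_betw_def)
  then show ?thesis
    using assms by (auto simp: Isom_def intro: bij_betw_trans)
qed

lemma Isom_in_mspace: "f \<in> Isom M \<Longrightarrow> x \<in> mspace M \<Longrightarrow> f x \<in> mspace M"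
  by (auto simp: Isom_def bij_betw_def)

lemma mdist_Isom:
  "f \<in> Isom M \<Longrightarrow> x \<in> mspace M \<Longrightarrow> y \<in> mspace M \<Longrightarrow> mdist M (f x) (f y) = mdist M x y"
  by (auto simp: Isom_def)

lemma Isom_inverse:
  assumes f: "f \<in> Isom M"
  obtains g where "g \<in> Isom M" "\<And>x. x \<in> mspace M \<Longrightarrow> g (f x) = x" "\<And>x. x \<in> mspace M \<Longrightarrow> f (g x) = x"
proof
  let ?g = "inv_into (mspace M) f"
  have bij: "bij_betw f (mspace M) (mspace M)" using f by (simp add: Isom_def)
  have bij': "bij_betw ?g (mspace M) (mspace M)" by (rule bij_betw_inv_into[OF bij])
  show gf: "?g (f x) = x" if "x \<in> mspace M" for x
    using bij_betw_inv_into_left[OF bij that] .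
  show fg: "f (?g x) = x" if "x \<in> mspace M" for x
    using bij_betw_inv_into_right[OF bij that] .
  have "mdist M (?g x) (?g y) = mdist M x y" if "x \<in> mspace M" "y \<in> mspace M" for x y
    using mdist_Isom[OF f, of "?g x" "?g y"] bij' that fg by (simp add: bij_betw_apply)
  then show "?g \<in> Isom M" using bij' by (simp add: Isom_def)
qed

definition transposable :: "'a metric \<Rightarrow> 'a \<Rightarrow> 'a \<Rightarrow> bool" where
  "transposable M x y \<longleftrightarrow>
     (\<exists>f\<in>Isom M. f x = y \<and> (\<forall>a\<in>mspace M. mdist M a x = mdist M a y \<longrightarrow> f a = a))"

text \<open>Induction on \<open>m\<close>.  If \<open>f\<close> takes \<open>A i\<close> to \<open>B i\<close> for \<open>i \<le> m\<close>, then each of these \<open>B i\<close> is equidistant from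
\<open>f (A (m + 1))\<close> and \<open>B (m + 1)\<close>, so an isometry transposing the latter corrects \<open>f\<close> without
disturbing what was achieved.\<close>

lemma point_homogeneous_if_transposable:
  assumes "\<And>x y. x \<in> mspace M \<Longrightarrow> y \<in> mspace M \<Longrightarrow> transposable M x y"
  shows "point_homogeneous m M"
proof (induction m)
  case 0
  show ?case using id_in_Isom by (auto simp: point_homogeneous_def)
next
  case (Suc m)
  show ?case
    unfolding point_homogeneous_def
  proof (intro allI impI)
    fix A B :: "nat \<Rightarrow> 'a"
    assume A: "\<forall>i\<in>{1..Suc m}. A i \<in> mspace M" and B: "\<forall>i\<in>{1..Suc m}. B i \<in> mspace M"
      and AB: "\<forall>i\<in>{1..Suc m}. \<forall>j\<in>{1..Suc m}. mdist M (A i) (A j) = mdist M (B i) (B j)"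
    have "(\<forall>i\<in>{1..m}. A i \<in> mspace M) \<and> (\<forall>i\<in>{1..m}. B i \<in> mspace M) \<and>
        (\<forall>i\<in>{1..m}. \<forall>j\<in>{1..m}. mdist M (A i) (A j) = mdist M (B i) (B j))"
      using A B AB by auto
    then obtain f where f: "f \<in> Isom M" "\<forall>i\<in>{1..m}. f (A i) = B i"
      using Suc unfolding point_homogeneous_def by blast
    let ?x = "f (A (Suc m))" and ?y = "B (Suc m)"
    have xy: "?x \<in> mspace M" "?y \<in> mspace M"
      using A B Isom_in_mspace[OF f(1)] by auto
    then obtain g where g: "g \<in> Isom M" "g ?x = ?y"
        and fix_g: "\<And>a. a \<in> mspace M \<Longrightarrow> mdist M a ?x = mdist M a ?y \<Longrightarrow> g a = a"
      using assms unfolding transposable_def by blast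
    have "g (B i) = B i" if i: "i \<in> {1..m}" for i
    proof (rule fix_g)
      have "mdist M (B i) ?x = mdist M (A i) (A (Suc m))"
        using mdist_Isom[OF f(1), of "A i" "A (Suc m)"] f(2) A i by simp
      then show "mdist M (B i) ?x = mdist M (B i) ?y" using AB i by simp
    qed (use B i in auto)
    then have "\<forall>i\<in>{1..Suc m}. (g \<circ> f) (A i) = B i"
      using f(2) g(2) by (auto simp: le_Suc_eq)
    then show "\<exists>f\<in>Isom M. \<forall>i\<in>{1..Suc m}. f (A i) = B i"
      using comp_in_Isom[OF f(1) g(1)] by blast
  qed
qed

text \<open>Conjugation by an isometry \<open>h\<close>: in a homogeneous situation only one choice of \<open>x\<close> has to be studied.\<close>

lemma transposable_Isom:
  assumes h: "h \<in> Isom M" and xy: "x \<in> mspace M" "y \<in> mspace M"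
    and tr: "transposable M (h x) (h y)"
  shows "transposable M x y"
proof -
  obtain k where k: "k \<in> Isom M" "\<And>x. x \<in> mspace M \<Longrightarrow> k (h x) = x"
    using Isom_inverse[OF h] by metis
  obtain f where f: "f \<in> Isom M" "f (h x) = h y"
      and fix_f: "\<And>a. a \<in> mspace M \<Longrightarrow> mdist M a (h x) = mdist M a (h y) \<Longrightarrow> f a = a"
    using tr unfolding transposable_def by blast
  have "k \<circ> (f \<circ> h) \<in> Isom M" using comp_in_Isom h f k by blast
  moreover have "(k \<circ> (f \<circ> h)) x = y" using f(2) k(2) xy by simp
  moreover have "(k \<circ> (f \<circ> h)) a = a" if "a \<in> mspace M" "mdist M a x = mdist M a y" for a
    using fix_f[of "h a"] that xy mdist_Isom[OF h] Isom_in_mspace[OF h] k(2) by simp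
  ultimately show ?thesis unfolding transposable_def by blast
qed

text \<open>By transitivity both pairs can be moved so as to start at \<open>a0\<close>; their second points then lie at the
same distance from \<open>a0\<close>, and the stabilizer of \<open>a0\<close> takes one to the other.\<close>

lemma two_point_homogeneous_if_stabilizer_transitive:
  assumes a0: "a0 \<in> mspace M"
    and trans: "\<And>x. x \<in> mspace M \<Longrightarrow> \<exists>f\<in>Isom M. f x = a0"
    and stab: "\<And>x y. \<lbrakk>x \<in> mspace M; y \<in> mspace M; mdist M a0 x = mdist M a0 y\<rbrakk>
                 \<Longrightarrow> \<exists>f\<in>Isom M. f a0 = a0 \<and> f x = y"
  shows "point_homogeneous 2 M"
  unfolding point_homogeneous_def
proof (intro allI impI)
  fix A B :: "nat \<Rightarrow> 'a"
  assume "\<forall>i\<in>{1..2}. A i \<in> mspace M" "\<forall>i\<in>{1..2}. B i \<in> mspace M"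
    and "\<forall>i\<in>{1..2}. \<forall>j\<in>{1..2}. mdist M (A i) (A j) = mdist M (B i) (B j)"
  then have A: "A 1 \<in> mspace M" "A 2 \<in> mspace M" and B: "B 1 \<in> mspace M" "B 2 \<in> mspace M"
    and AB: "mdist M (A 1) (A 2) = mdist M (B 1) (B 2)" by auto
  obtain f where f: "f \<in> Isom M" "f (A 1) = a0" using trans A by blast
  obtain g where g: "g \<in> Isom M" "g (B 1) = a0" using trans B by blast
  obtain k where k: "k \<in> Isom M" "\<And>x. x \<in> mspace M \<Longrightarrow> k (g x) = x"
    using Isom_inverse[OF g(1)] by metis
  have "mdist M a0 (f (A 2)) = mdist M a0 (g (B 2))"
    using mdist_Isom[OF f(1) A] mdist_Isom[OF g(1) B] f(2) g(2) AB by simp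
  then obtain h where h: "h \<in> Isom M" "h a0 = a0" "h (f (A 2)) = g (B 2)"
    using stab Isom_in_mspace[OF f(1)] Isom_in_mspace[OF g(1)] A B by blast
  have "k \<circ> (h \<circ> f) \<in> Isom M" using comp_in_Isom f h k by blast
  moreover have "(k \<circ> (h \<circ> f)) (A 1) = B 1" "(k \<circ> (h \<circ> f)) (A 2) = B 2"
    using f(2) h(2,3) k(2)[OF B(1)] k(2)[OF B(2)] g(2) by simp_all
  moreover have "{1..2::nat} = {1, 2}" by auto
  ultimately show "\<exists>f\<in>Isom M. \<forall>i\<in>{1..2}. f (A i) = B i" by (metis insert_iff singletonD)
qed

lemma point_homogeneous_scaling:
  assumes h: "bij_betw h (mspace M) (mspace N)" and c: "c \<noteq> 0"
    and d: "\<And>x y. x \<in> mspace M \<Longrightarrow> y \<in> mspace M \<Longrightarrow> mdist N (h x) (h y) = c * mdist M x y"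
    and M: "point_homogeneous m M"
  shows "point_homogeneous m N"
  unfolding point_homogeneous_def
proof (intro allI impI)
  fix A B :: "nat \<Rightarrow> 'b"
  assume A: "\<forall>i\<in>{1..m}. A i \<in> mspace N" and B: "\<forall>i\<in>{1..m}. B i \<in> mspace N"
    and AB: "\<forall>i\<in>{1..m}. \<forall>j\<in>{1..m}. mdist N (A i) (A j) = mdist N (B i) (B j)"
  define k where "k = inv_into (mspace M) h"
  have k: "bij_betw k (mspace N) (mspace M)"
    unfolding k_def by (rule bij_betw_inv_into[OF h])
  have hk: "h (k x) = x" if "x \<in> mspace N" for x
    unfolding k_def using bij_betw_inv_into_right[OF h that] .
  have kin: "k x \<in> mspace M" if "x \<in> mspace N" for x using k that by (rule bij_betw_apply)
  have dk: "mdist N x y = c * mdist M (k x) (k y)" if "x \<in> mspace N" "y \<in> mspace N" for x y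
    using d[of "k x" "k y"] kin hk that by simp
  have "\<forall>i\<in>{1..m}. \<forall>j\<in>{1..m}. mdist M (k (A i)) (k (A j)) = mdist M (k (B i)) (k (B j))"
    using AB A B c by (simp add: dk)
  then obtain f where f: "f \<in> Isom M" "\<forall>i\<in>{1..m}. f (k (A i)) = k (B i)"
    using M[unfolded point_homogeneous_def, rule_format, of "\<lambda>i. k (A i)" "\<lambda>i. k (B i)"] A B kin by auto
  have "bij_betw (h \<circ> (f \<circ> k)) (mspace N) (mspace N)"
    using h k f(1) unfolding Isom_def by (blast intro: bij_betw_trans)
  moreover have "mdist N (h (f (k x))) (h (f (k y))) = mdist N x y" if "x \<in> mspace N" "y \<in> mspace N" for x y
    using that by (simp add: d dk kin Isom_in_mspace[OF f(1)] mdist_Isom[OF f(1)])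
  ultimately have "h \<circ> (f \<circ> k) \<in> Isom N" by (simp add: Isom_def)
  moreover have "\<forall>i\<in>{1..m}. (h \<circ> (f \<circ> k)) (A i) = B i" using f(2) hk B by simp
  ultimately show "\<exists>f\<in>Isom N. \<forall>i\<in>{1..m}. f (A i) = B i" by blast
qed

section \<open>Polytopes inscribed in a sphere\<close>

abbreviation vertex_space :: "'a::euclidean_space set \<Rightarrow> 'a metric" where
  "vertex_space V \<equiv> submetric euclidean_metric V"

text \<open>A ball is strictly convex: an inner point of a segment is closer to the centre than the farther of
the two end points, so a point of the sphere is not an inner point of a segment in the ball.\<close>

lemma polytope_vertices_inscribed:
  assumes "W \<subseteq> sphere a r"
  shows "polytope_vertices (convex hull W) = W"
proof
  show "polytope_vertices (convex hull W) \<subseteq> W"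
    by (simp add: polytope_vertices_def extreme_points_of_convex_hull)
  have hull: "convex hull W \<subseteq> cball a r"
    using assms by (intro hull_minimal) (auto simp: subset_eq)
  show "W \<subseteq> polytope_vertices (convex hull W)"
  proof
    fix w assume w: "w \<in> W"
    have "w \<notin> open_segment p q" if "p \<in> convex hull W" "q \<in> convex hull W" for p q
    proof
      assume "w \<in> open_segment p q"
      then have "dist a w < dist a p \<or> dist a w < dist a q"
        by (rule dist_decreases_open_segment[rule_format])
      moreover have "dist a p \<le> r" "dist a q \<le> r" "dist a w = r"
        using hull that w assms by auto
      ultimately show False by simp
    qed
    then show "w \<in> polytope_vertices (convex hull W)"
      using w by (simp add: polytope_vertices_def extreme_point_of_def hull_inc)
  qed
qed

text \<open>Up to a translation a similarity is linear, so it takes the convex hull of \<open>V\<close> to the convex hull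
of the image of \<open>V\<close>, which is inscribed in the image of the sphere.\<close>

lemma point_homogeneous_polytope_similar:
  assumes "finite V" "V \<subseteq> sphere 0 r" "similar (convex hull V) P"
  shows "point_homogeneous_polytope m P \<longleftrightarrow> point_homogeneous m (vertex_space V)"
proof -
  obtain f c where c: "c > 0" and f: "bij f" "\<And>x y. dist (f x) (f y) = c * dist x y"
    and P: "P = f ` (convex hull V)"
    using assms(3) unfolding similar_def by blast
  define g where "g x = f x - f 0" for x
  have "linear g"
    by (rule scaling_linear[of _ c]) (auto simp: g_def dist_norm f(2)[unfolded dist_norm])
  have fg: "f = (\<lambda>x. f 0 + x) \<circ> g" by (auto simp: g_def)
  have hull: "P = convex hull (f ` V)"
    unfolding P by (subst (1 2) fg)
      (simp only: image_comp[symmetric] convex_hull_linear_image[OF \<open>linear g\<close>] convex_hull_translation)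
  have "f ` V \<subseteq> sphere (f 0) (c * r)" using assms(2) by (auto simp: f(2))
  then have vert: "polytope_vertices P = f ` V"
    unfolding hull by (rule polytope_vertices_inscribed)
  have poly: "polytope P"
    using assms(1) unfolding hull by (simp add: polytope_convex_hull)
  have bij: "bij_betw f V (f ` V)"
    using f(1) by (meson bij_betw_subset subset_UNIV bij_betw_def inj_on_subset)
  have bij': "bij_betw (inv_into V f) (f ` V) V" by (rule bij_betw_inv_into[OF bij])
  have "point_homogeneous m (vertex_space V) \<Longrightarrow> point_homogeneous m (vertex_space (f ` V))"
    by (rule point_homogeneous_scaling[of f _ _ c]) (use bij c f(2) in auto)
  moreover have "point_homogeneous m (vertex_space (f ` V)) \<Longrightarrow> point_homogeneous m (vertex_space V)"
  proof (rule point_homogeneous_scaling[of "inv_into V f" _ _ "1 / c"])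
    fix x y assume "x \<in> mspace (vertex_space (f ` V))" "y \<in> mspace (vertex_space (f ` V))"
    then show "mdist (vertex_space V) (inv_into V f x) (inv_into V f y) = 1 / c * mdist (vertex_space (f ` V)) x y"
      using f(2)[of "inv_into V f x" "inv_into V f y"] c by (simp add: f_inv_into_f)
  qed (use bij' c in auto)
  ultimately show ?thesis
    using poly vert unfolding point_homogeneous_polytope_def by auto
qed

lemma homogeneous_polytope_if_transposable:
  assumes "finite V" "V \<subseteq> sphere 0 r" "similar (convex hull V) P"
    and "\<And>x y. x \<in> V \<Longrightarrow> y \<in> V \<Longrightarrow> transposable (vertex_space V) x y"
  shows "point_homogeneous_polytope m P"
  using point_homogeneous_polytope_similar[OF assms(1-3)]
    point_homogeneous_if_transposable[of "vertex_space V"] assms(4) by auto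

section \<open>Mirrors\<close>

text \<open>Degenerate normals do no harm: division by zero makes \<open>reflection 0\<close> the identity.\<close>

definition reflection :: "'a::real_inner \<Rightarrow> 'a \<Rightarrow> 'a" where
  "reflection n v = v - (2 * (v \<bullet> n) / (n \<bullet> n)) *\<^sub>R n"

lemma orthogonal_transformation_reflection: "orthogonal_transformation (reflection n)"
proof (cases "n = 0")
  case False
  show ?thesis
    unfolding orthogonal_transformation_def
  proof
    show "linear (reflection n)"
      by (rule linearI) (auto simp: reflection_def algebra_simps inner_add_left add_divide_distrib)
    show "\<forall>v w. reflection n v \<bullet> reflection n w = v \<bullet> w"
      using False by (auto simp: reflection_def inner_diff_left inner_diff_right inner_commute field_simps)
  qed
qed (simp add: reflection_def[abs_def] orthogonal_transformation_def linear_id[unfolded id_def])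

definition mirror :: "'a::real_inner set \<Rightarrow> 'a \<Rightarrow> bool" where
  "mirror V n \<longleftrightarrow> (\<forall>v\<in>V. reflection n v \<in> V)"

lemma mirror_0: "mirror V 0"
  by (simp add: mirror_def reflection_def)

lemma mirror_scaleR: "mirror V n \<Longrightarrow> mirror V (k *\<^sub>R n)"
  by (cases "k = 0") (auto simp: mirror_def reflection_def field_simps)

lemma orthogonal_transformation_permutes:
  assumes "orthogonal_transformation g" "finite V" "g ` V \<subseteq> V"
  shows "bij_betw g V V"
proof -
  have "inj_on g V"
    using orthogonal_transformation_inj[OF assms(1)] by (rule inj_on_subset) simp
  then show ?thesis using assms(2,3) by (simp add: bij_betw_def endo_inj_surj)
qed

lemma orthogonal_transformation_in_Isom:
  assumes "orthogonal_transformation g" "finite V" "g ` V \<subseteq> V"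
  shows "g \<in> Isom (vertex_space V)"
  using orthogonal_transformation_permutes[OF assms] assms(1)
  by (auto simp: Isom_def orthogonal_transformation_isometry)

lemma mirror_orthogonal_transformation:
  assumes g: "orthogonal_transformation g" "finite V" "g ` V \<subseteq> V" and n: "mirror V n"
  shows "mirror V (g n)"
  unfolding mirror_def
proof
  fix v assume "v \<in> V"
  then obtain u where u: "u \<in> V" "v = g u"
    using orthogonal_transformation_permutes[OF g] by (auto simp: bij_betw_def)
  have "linear g" using g(1) by (rule orthogonal_transformation_linear)
  have "reflection (g n) (g u) = g (reflection n u)"
    using g(1) by (simp add: reflection_def linear_diff[OF \<open>linear g\<close>] linear_cmul[OF \<open>linear g\<close>]
        orthogonal_transformation_def)
  then show "reflection (g n) v \<in> V" using u n g(3) by (auto simp: mirror_def)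
qed

lemma mirror_in_Isom: "finite V \<Longrightarrow> mirror V n \<Longrightarrow> reflection n \<in> Isom (vertex_space V)"
  by (rule orthogonal_transformation_in_Isom) (auto simp: orthogonal_transformation_reflection mirror_def)

lemma reflection_diff:
  assumes "norm x = norm y"
  shows "reflection (x - y) x = y" "reflection (x - y) y = x"
proof -
  have eq: "x \<bullet> x = y \<bullet> y" using assms by (simp add: norm_eq)
  have "reflection (x - y) x = y \<and> reflection (x - y) y = x"
  proof (cases "x = y")
    case False
    then have "(x - y) \<bullet> (x - y) \<noteq> 0" by simp
    moreover have "2 * (x \<bullet> (x - y)) = (x - y) \<bullet> (x - y)" "2 * (y \<bullet> (x - y)) = - ((x - y) \<bullet> (x - y))"
      using eq by (simp_all add: inner_diff_left inner_diff_right inner_commute)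
    ultimately show ?thesis by (simp add: reflection_def)
  qed (simp add: reflection_def)
  then show "reflection (x - y) x = y" "reflection (x - y) y = x" by simp_all
qed

lemma reflection_equidistant:
  assumes "norm x = norm y" "dist a x = dist a y"
  shows "reflection (x - y) a = a"
proof -
  have "x \<bullet> x = y \<bullet> y" using assms(1) by (simp add: norm_eq)
  moreover have "(a - x) \<bullet> (a - x) = (a - y) \<bullet> (a - y)"
    using assms(2) by (simp add: dist_norm norm_eq)
  ultimately have "a \<bullet> (x - y) = 0"
    by (simp add: inner_diff_left inner_diff_right inner_commute)
  then show ?thesis by (simp add: reflection_def)
qed

lemma transposable_mirror:
  assumes "finite V" "norm x = norm y" "mirror V (x - y)"
  shows "transposable (vertex_space V) x y"
  unfolding transposable_def
  by (rule bexI[of _ "reflection (x - y)"])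
    (use assms in \<open>auto simp: reflection_diff reflection_equidistant mirror_in_Isom\<close>)

text \<open>The points equidistant from \<open>x\<close> and \<open>- x\<close> are those orthogonal to \<open>x\<close>, so the central symmetry has nothing to fix.\<close>

lemma transposable_antipodal:
  assumes "finite V" "\<And>a. a \<in> V \<Longrightarrow> - a \<in> V" and nz: "\<And>a. a \<in> V \<Longrightarrow> a \<bullet> x \<noteq> 0"
  shows "transposable (vertex_space V) x (- x)"
proof -
  have "uminus \<in> Isom (vertex_space V)"
    by (rule orthogonal_transformation_in_Isom)
      (use assms in \<open>auto simp: orthogonal_transformation_isometry dist_minus\<close>)
  moreover have "dist a x \<noteq> dist a (- x)" if "a \<in> V" for a
    using nz[OF that] by (auto simp: dist_norm norm_eq algebra_simps inner_commute)
  ultimately show ?thesis unfolding transposable_def by (intro bexI[of _ uminus]) auto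
qed

text \<open>For explicit vectors, giving \<open>k\<close> turns the reflection into a subtraction without division.
The mirror normals of the icosahedron and of the dodecahedron below are scaled to squared length 4.\<close>

lemma reflection_in:
  assumes "n \<bullet> n = 4" "v \<bullet> n = 2 * k" "v - k *\<^sub>R n \<in> V" shows "reflection n v \<in> V"
  using assms by (simp add: reflection_def)

text \<open>Reflections commute with \<open>v \<mapsto> - v\<close>, so one vertex of each antipodal pair has to be inspected.\<close>

lemma mirror_up_to_sign:
  assumes "\<And>v. v \<in> V \<Longrightarrow> - v \<in> V" "\<And>v. v \<in> V \<Longrightarrow> v \<in> S \<or> - v \<in> S"
    and "\<And>v. v \<in> S \<Longrightarrow> reflection n v \<in> V"
  shows "mirror V n"
  unfolding mirror_def
proof
  fix v assume "v \<in> V"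
  then consider "v \<in> S" | "- v \<in> S" using assms(2) by blast
  then show "reflection n v \<in> V"
  proof cases
    case 2
    have "reflection n v = - reflection n (- v)" by (simp add: reflection_def)
    then show ?thesis using assms(1,3) 2 by metis
  qed (rule assms(3))
qed

section \<open>The regular tetrahedron\<close>

definition tetrahedron_vertices :: "(real^3) set" where
  "tetrahedron_vertices = {vector [1, 1, 1], vector [1, -1, -1], vector [-1, 1, -1], vector [-1, -1, 1]}"

lemma tetrahedron_vertices_norm: "v \<in> tetrahedron_vertices \<Longrightarrow> norm v = sqrt 3"
  by (auto simp: tetrahedron_vertices_def norm_eq_sqrt_inner inner_vec_def sum_3)

lemma tetrahedron_vertices_dist:
  "x \<in> tetrahedron_vertices \<Longrightarrow> y \<in> tetrahedron_vertices \<Longrightarrow> x \<noteq> y \<Longrightarrow> dist x y = sqrt 8"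
  by (auto simp: tetrahedron_vertices_def dist_norm norm_eq_sqrt_inner inner_vec_def sum_3)

text \<open>All vertices other than \<open>x\<close> and \<open>y\<close> are equidistant from them, hence lie on the mirror.\<close>

lemma tetrahedron_mirror:
  assumes xy: "x \<in> tetrahedron_vertices" "y \<in> tetrahedron_vertices"
  shows "mirror tetrahedron_vertices (x - y)"
  unfolding mirror_def
proof
  fix v assume v: "v \<in> tetrahedron_vertices"
  have norm: "norm x = norm y" using xy by (simp add: tetrahedron_vertices_norm)
  consider "v = x" | "v = y" | "dist v x = dist v y"
    using tetrahedron_vertices_dist v xy by metis
  then show "reflection (x - y) v \<in> tetrahedron_vertices"
    using v xy by cases (simp_all add: reflection_diff[OF norm] reflection_equidistant[OF norm])
qed

lemma tetrahedron_homogeneous: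
  assumes "regular_tetrahedron P"
  shows "point_homogeneous_polytope m P"
proof (rule homogeneous_polytope_if_transposable)
  show "similar (convex hull tetrahedron_vertices) P"
    using assms by (simp add: regular_tetrahedron_def tetrahedron_vertices_def)
  show fin: "finite tetrahedron_vertices" by (simp add: tetrahedron_vertices_def)
  show "tetrahedron_vertices \<subseteq> sphere 0 (sqrt 3)"
    by (auto simp: tetrahedron_vertices_norm)
  show "transposable (vertex_space tetrahedron_vertices) x y"
    if "x \<in> tetrahedron_vertices" "y \<in> tetrahedron_vertices" for x y
    using that by (simp add: transposable_mirror fin tetrahedron_mirror tetrahedron_vertices_norm)
qed

section \<open>The regular octahedron\<close>

definition octahedron_vertices :: "(real^3) set" where
  "octahedron_vertices = (\<Union>i. {axis i 1, axis i (-1)})"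

lemma finite_octahedron_vertices: "finite octahedron_vertices"
  by (simp add: octahedron_vertices_def)

lemma octahedron_vertices_norm: "v \<in> octahedron_vertices \<Longrightarrow> norm v = 1"
  by (auto simp: octahedron_vertices_def norm_eq_sqrt_inner inner_axis_axis)

lemma octahedron_vertices_uminus: "v \<in> octahedron_vertices \<Longrightarrow> - v \<in> octahedron_vertices"
  by (auto simp: octahedron_vertices_def axis_def vec_eq_iff)

lemma octahedron_vertices_cases:
  assumes "x \<in> octahedron_vertices" "y \<in> octahedron_vertices"
  shows "x = y \<or> x = - y \<or> x \<bullet> y = 0"
  using assms by (auto simp: octahedron_vertices_def inner_axis_axis) (auto simp: axis_def vec_eq_iff)

text \<open>The vertices are the points of an orthonormal frame and their negatives: those different
from \<open>\<plusminus>x\<close> and \<open>\<plusminus>y\<close> are orthogonal to \<open>x - y\<close> and lie on the mirror.\<close>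

lemma octahedron_mirror:
  assumes xy: "x \<in> octahedron_vertices" "y \<in> octahedron_vertices"
  shows "mirror octahedron_vertices (x - y)"
  unfolding mirror_def
proof
  fix v assume v: "v \<in> octahedron_vertices"
  have norm: "norm x = norm y" using xy by (simp add: octahedron_vertices_norm)
  have minus: "reflection (x - y) (- u) = - reflection (x - y) u" for u
    by (simp add: reflection_def)
  consider "v = x" | "v = y" | "v = - x" | "v = - y" | "v \<bullet> x = 0" "v \<bullet> y = 0"
    using octahedron_vertices_cases v xy by blast
  then show "reflection (x - y) v \<in> octahedron_vertices"
  proof cases
    case 5
    then have "reflection (x - y) v = v" by (simp add: reflection_def inner_diff_right)
    then show ?thesis using v by simp
  qed (use xy in \<open>simp_all add: minus reflection_diff[OF norm] octahedron_vertices_uminus\<close>)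
qed

lemma octahedron_homogeneous:
  assumes "regular_octahedron P"
  shows "point_homogeneous_polytope m P"
proof (rule homogeneous_polytope_if_transposable)
  show "similar (convex hull octahedron_vertices) P"
    using assms by (simp add: regular_octahedron_def octahedron_vertices_def)
  show fin: "finite octahedron_vertices" by (simp add: finite_octahedron_vertices)
  show "octahedron_vertices \<subseteq> sphere 0 1"
    by (auto simp: octahedron_vertices_norm)
  show "transposable (vertex_space octahedron_vertices) x y"
    if "x \<in> octahedron_vertices" "y \<in> octahedron_vertices" for x y
    using that by (simp add: transposable_mirror fin octahedron_mirror octahedron_vertices_norm)
qed

section \<open>Sign changes and cyclic shifts of coordinates\<close>

lemmas vec3_simps = vec_eq_iff forall_3 inner_vec_def sum_3

definition cube_vertices :: "(real^3) set" where
  "cube_vertices = {x. \<forall>i. x $ i \<in> {-1, 1}}"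

lemma cube_vertices_iff: "x \<in> cube_vertices \<longleftrightarrow> \<bar>x$1\<bar> = 1 \<and> \<bar>x$2\<bar> = 1 \<and> \<bar>x$3\<bar> = 1"
  by (auto simp: cube_vertices_def forall_3 abs_if)

lemma cube_verticesE:
  assumes "v \<in> cube_vertices"
  obtains a b c where "v = vector [a, b, c]" "a = -1 \<or> a = 1" "b = -1 \<or> b = 1" "c = -1 \<or> c = 1"
proof
  show "v = vector [v$1, v$2, v$3]" by (simp add: vec_eq_iff forall_3)
qed (use assms in \<open>auto simp: cube_vertices_def\<close>)

lemma finite_vec3: "finite A \<Longrightarrow> finite {x :: real^3. \<forall>i. x $ i \<in> A}"
proof -
  assume A: "finite A"
  have "{x :: real^3. \<forall>i. x $ i \<in> A} \<subseteq> (\<lambda>(a, b, c). vector [a, b, c]) ` (A \<times> A \<times> A)"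
    by (force simp: image_iff vec_eq_iff forall_3)
  then show ?thesis using A by (meson finite_SigmaI finite_imageI finite_subset)
qed

lemma finite_cube_vertices: "finite cube_vertices"
  unfolding cube_vertices_def by (rule finite_vec3) simp

definition sign_change :: "real^3 \<Rightarrow> real^3 \<Rightarrow> real^3" where
  "sign_change s v = (\<chi> i. s $ i * v $ i)"

definition cyclic_shift :: "real^3 \<Rightarrow> real^3" where
  "cyclic_shift v = vector [v $ 3, v $ 1, v $ 2]"

lemma orthogonal_sign_change:
  assumes "s \<in> cube_vertices" shows "orthogonal_transformation (sign_change s)"
  using assms unfolding orthogonal_transformation_def cube_vertices_def
  by (auto intro!: linearI simp: sign_change_def vec3_simps algebra_simps)

lemma orthogonal_cyclic_shift: "orthogonal_transformation cyclic_shift"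
  unfolding orthogonal_transformation_def
  by (auto intro!: linearI simp: cyclic_shift_def vec3_simps algebra_simps)

text \<open>Sign changes and cyclic shifts of the coordinates generate the pyritohedral group, of order 24, which
is a common subgroup of the symmetry groups of the cube, the icosahedron and the dodecahedron.
Working modulo this group leaves few cases to compute.\<close>

definition pyritohedral :: "(real^3) set \<Rightarrow> bool" where
  "pyritohedral V \<longleftrightarrow> finite V \<and> (\<forall>v\<in>V. cyclic_shift v \<in> V) \<and> (\<forall>s\<in>cube_vertices. \<forall>v\<in>V. sign_change s v \<in> V)"

lemma pyritohedral_cube_vertices: "pyritohedral cube_vertices"
  by (simp add: pyritohedral_def cube_vertices_iff finite_cube_vertices cyclic_shift_def sign_change_def abs_mult)

text \<open>With absolute values the coordinate signs disappear, and invariance under sign changes becomes obvious.\<close>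

lemma cyclic_points_iff:
  assumes "0 \<le> a" "0 \<le> b"
  shows "x \<in> cyclic_points a b \<longleftrightarrow>
    x$1 = 0 \<and> \<bar>x$2\<bar> = a \<and> \<bar>x$3\<bar> = b \<or> \<bar>x$1\<bar> = a \<and> \<bar>x$2\<bar> = b \<and> x$3 = 0 \<or> \<bar>x$1\<bar> = b \<and> x$2 = 0 \<and> \<bar>x$3\<bar> = a"
  using assms by (auto simp: cyclic_points_def vec_eq_iff forall_3 abs_if)

lemma pyritohedral_cyclic_points:
  assumes "0 \<le> a" "0 \<le> b" shows "pyritohedral (cyclic_points a b)"
proof -
  have "finite (cyclic_points a b)" by (simp add: cyclic_points_def)
  then show ?thesis
    by (auto simp: pyritohedral_def cyclic_points_iff[OF assms] cube_vertices_iff cyclic_shift_def sign_change_def abs_mult)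
qed

lemma pyritohedral_Un: "pyritohedral V \<Longrightarrow> pyritohedral W \<Longrightarrow> pyritohedral (V \<union> W)"
  by (auto simp: pyritohedral_def)

lemma pyritohedral_uminus:
  assumes "pyritohedral V" "v \<in> V" shows "- v \<in> V"
proof -
  have "vector [-1, -1, -1] \<in> cube_vertices" by (simp add: cube_vertices_iff)
  then have "sign_change (vector [-1, -1, -1]) v \<in> V"
    using assms by (auto simp: pyritohedral_def)
  moreover have "sign_change (vector [-1, -1, -1]) v = - v"
    by (simp add: sign_change_def vec_eq_iff forall_3)
  ultimately show ?thesis by simp
qed

lemma sign_change_in_Isom:
  "pyritohedral V \<Longrightarrow> s \<in> cube_vertices \<Longrightarrow> sign_change s \<in> Isom (vertex_space V)"
  by (rule orthogonal_transformation_in_Isom) (auto simp: orthogonal_sign_change pyritohedral_def)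

lemma cyclic_shift_in_Isom: "pyritohedral V \<Longrightarrow> cyclic_shift \<in> Isom (vertex_space V)"
  by (rule orthogonal_transformation_in_Isom) (auto simp: orthogonal_cyclic_shift pyritohedral_def)

lemma mirror_sign_change:
  "pyritohedral V \<Longrightarrow> s \<in> cube_vertices \<Longrightarrow> mirror V n \<Longrightarrow> mirror V (sign_change s n)"
  by (rule mirror_orthogonal_transformation) (auto simp: orthogonal_sign_change pyritohedral_def)

lemma mirror_cyclic_shift: "pyritohedral V \<Longrightarrow> mirror V n \<Longrightarrow> mirror V (cyclic_shift n)"
  by (rule mirror_orthogonal_transformation) (auto simp: orthogonal_cyclic_shift pyritohedral_def)

text \<open>The reflection in a coordinate plane changes one sign.\<close>

lemma mirror_axes:
  assumes V: "pyritohedral V"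
  shows "mirror V (vector [k, 0, 0])" "mirror V (vector [0, k, 0])" "mirror V (vector [0, 0, k])"
proof -
  have *: "mirror V (vector [k, 0, 0])" for k
  proof (cases "k = 0")
    case True
    then have "(vector [k, 0, 0] :: real^3) = 0" by (simp add: vec_eq_iff forall_3)
    then show ?thesis by (simp only: mirror_0)
  next
    case False
    have "vector [-1, 1, 1] \<in> cube_vertices" by (simp add: cube_vertices_iff)
    moreover have "reflection (vector [k, 0, 0]) = sign_change (vector [-1, 1, 1])"
      using False by (simp add: fun_eq_iff reflection_def sign_change_def vec3_simps)
    ultimately show ?thesis using V by (auto simp: mirror_def pyritohedral_def)
  qed
  have shift: "cyclic_shift (vector [k, 0, 0]) = vector [0, k, 0]"
    "cyclic_shift (vector [0, k, 0]) = vector [0, 0, k]" by (simp_all add: cyclic_shift_def)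
  show "mirror V (vector [k, 0, 0])" by (rule *)
  show **: "mirror V (vector [0, k, 0])" using mirror_cyclic_shift[OF V *, of k] by (simp add: shift)
  show "mirror V (vector [0, 0, k])" using mirror_cyclic_shift[OF V **] by (simp add: shift)
qed

lemma mirror_all_signs:
  assumes V: "pyritohedral V" and n: "mirror V (vector [a, b, c])"
    and eq: "\<bar>n$1\<bar> = \<bar>a\<bar>" "\<bar>n$2\<bar> = \<bar>b\<bar>" "\<bar>n$3\<bar> = \<bar>c\<bar>"
  shows "mirror V n"
proof -
  define s :: "real^3" where
    "s = vector [if n$1 = a then 1 else -1, if n$2 = b then 1 else -1, if n$3 = c then 1 else -1]"
  have "s \<in> cube_vertices" by (simp add: s_def cube_vertices_iff)
  moreover have "sign_change s (vector [a, b, c]) = n"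
    using eq by (auto simp: s_def sign_change_def vec_eq_iff forall_3 abs_eq_iff)
  ultimately show ?thesis using mirror_sign_change[OF V _ n] by metis
qed

text \<open>One mirror yields its whole orbit under sign changes and cyclic shifts.  The factor \<open>k\<close>
accounts for normals given as differences of vertices, whose length varies.\<close>

lemma mirror_root:
  assumes V: "pyritohedral V" and mir: "mirror V (vector [a, b, c])" and "0 \<le> k"
    and n: "\<bar>n$1\<bar> = k * \<bar>a\<bar> \<and> \<bar>n$2\<bar> = k * \<bar>b\<bar> \<and> \<bar>n$3\<bar> = k * \<bar>c\<bar> \<or>
      \<bar>n$1\<bar> = k * \<bar>c\<bar> \<and> \<bar>n$2\<bar> = k * \<bar>a\<bar> \<and> \<bar>n$3\<bar> = k * \<bar>b\<bar> \<or>
      \<bar>n$1\<bar> = k * \<bar>b\<bar> \<and> \<bar>n$2\<bar> = k * \<bar>c\<bar> \<and> \<bar>n$3\<bar> = k * \<bar>a\<bar>"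
  shows "mirror V n"
proof -
  have "mirror V (k *\<^sub>R vector [a, b, c])" by (rule mirror_scaleR[OF mir])
  moreover have "k *\<^sub>R vector [a, b, c] = (vector [k * a, k * b, k * c] :: real^3)"
    by (simp add: vec_eq_iff forall_3)
  ultimately have 1: "mirror V (vector [k * a, k * b, k * c])" by simp
  have 2: "mirror V (vector [k * c, k * a, k * b])"
    using mirror_cyclic_shift[OF V 1] by (simp add: cyclic_shift_def)
  have 3: "mirror V (vector [k * b, k * c, k * a])"
    using mirror_cyclic_shift[OF V 2] by (simp add: cyclic_shift_def)
  have k: "k * \<bar>x\<bar> = \<bar>k * x\<bar>" for x using \<open>0 \<le> k\<close> by (simp add: abs_mult)
  from n show ?thesis
    unfolding k using mirror_all_signs[OF V 1] mirror_all_signs[OF V 2] mirror_all_signs[OF V 3] by blast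
qed

lemma cyclic_points_up_to_sign:
  assumes "v \<in> cyclic_points a b"
  defines "S \<equiv> {vector [0, a, b], vector [0, a, - b], vector [a, b, 0], vector [a, - b, 0],
    vector [b, 0, a], vector [b, 0, - a]}"
  shows "v \<in> S \<or> - v \<in> S"
proof -
  obtain s t where "s = - a \<or> s = a" "t = - b \<or> t = b"
    "v = vector [0, s, t] \<or> v = vector [s, t, 0] \<or> v = vector [t, 0, s]"
    using assms(1) unfolding cyclic_points_def by blast
  moreover have "- vector [x, y, z] = (vector [- x, - y, - z] :: real^3)" for x y z
    by (simp add: vec_eq_iff forall_3)
  ultimately show ?thesis unfolding S_def by (elim disjE) simp_all
qed

lemma cyclic_points_norm: "v \<in> cyclic_points a b \<Longrightarrow> norm v = sqrt (a * a + b * b)"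
  by (auto simp: cyclic_points_def norm_eq_sqrt_inner inner_vec_def sum_3 add.commute)

text \<open>A power of the cyclic shift brings the zero coordinate to the front.  The power is kept explicit
since, unlike sign changes, cyclic shifts fix \<open>(1, 1, 1)\<close>.\<close>

lemma cyclic_points_shift:
  assumes "0 \<le> a" "0 \<le> b" "x \<in> cyclic_points a b"
  obtains g where "g \<in> {\<lambda>x. x, cyclic_shift, cyclic_shift \<circ> cyclic_shift}"
    "(g x)$1 = 0" "\<bar>(g x)$2\<bar> = a" "\<bar>(g x)$3\<bar> = b"
proof -
  consider "x$1 = 0" "\<bar>x$2\<bar> = a" "\<bar>x$3\<bar> = b" | "\<bar>x$1\<bar> = a" "\<bar>x$2\<bar> = b" "x$3 = 0"
    | "\<bar>x$1\<bar> = b" "x$2 = 0" "\<bar>x$3\<bar> = a"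
    using assms(3) cyclic_points_iff[OF assms(1,2)] by blast
  then show thesis
  proof cases
    case 1
    then show ?thesis by (intro that[of "\<lambda>x. x"]) auto
  next
    case 2
    then show ?thesis by (intro that[of cyclic_shift]) (auto simp: cyclic_shift_def)
  next
    case 3
    then show ?thesis by (intro that[of "cyclic_shift \<circ> cyclic_shift"]) (auto simp: cyclic_shift_def)
  qed
qed

lemma cyclic_points_transitive:
  assumes V: "pyritohedral V" and x: "0 \<le> a" "0 \<le> b" "x \<in> cyclic_points a b"
  obtains h where "h \<in> Isom (vertex_space V)" "h x = vector [0, a, b]"
proof -
  obtain g where g: "g \<in> {\<lambda>x. x, cyclic_shift, cyclic_shift \<circ> cyclic_shift}"
    "(g x)$1 = 0" "\<bar>(g x)$2\<bar> = a" "\<bar>(g x)$3\<bar> = b"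
    using cyclic_points_shift[OF x] .
  have Isom_g: "g \<in> Isom (vertex_space V)"
    using g(1) id_in_Isom cyclic_shift_in_Isom[OF V] comp_in_Isom by blast
  define s :: "real^3" where
    "s = vector [1, if (g x)$2 = a then 1 else -1, if (g x)$3 = b then 1 else -1]"
  have "s \<in> cube_vertices" by (simp add: s_def cube_vertices_iff)
  then have "sign_change s \<circ> g \<in> Isom (vertex_space V)"
    by (rule comp_in_Isom[OF Isom_g sign_change_in_Isom[OF V]])
  moreover have "(sign_change s \<circ> g) x = vector [0, a, b]"
    using g(2-4) by (auto simp: s_def sign_change_def vec_eq_iff forall_3)
  ultimately show thesis by (rule that)
qed

section \<open>The cube\<close>

lemma cube_diagonal_mirror: "mirror cube_vertices (vector [1, 1, 0])"
  unfolding mirror_def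
proof
  fix v assume v: "v \<in> cube_vertices"
  have "reflection (vector [1, 1, 0]) v = vector [- v$2, - v$1, v$3]"
    by (simp add: reflection_def vec3_simps field_simps)
  then show "reflection (vector [1, 1, 0]) v \<in> cube_vertices"
    using v by (simp add: cube_vertices_iff)
qed

lemma cube_vertices_norm: "v \<in> cube_vertices \<Longrightarrow> norm v = sqrt 3"
  by (auto simp: cube_vertices_iff norm_eq_sqrt_inner inner_vec_def sum_3 abs_if split: if_splits)

lemma cube_inner_nonzero:
  "v \<in> cube_vertices \<Longrightarrow> w \<in> cube_vertices \<Longrightarrow> v \<bullet> w \<noteq> 0"
  by (auto simp: cube_vertices_iff inner_vec_def sum_3 abs_if split: if_splits)

text \<open>A sign change takes \<open>x\<close> to \<open>u = (1, 1, 1)\<close>.  The difference \<open>u - z\<close> of \<open>u\<close> and another vertex has 2 at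
the coordinates where they differ and 0 elsewhere; it is a mirror normal when there are at most two
such coordinates.  Three mean that \<open>z\<close> is opposite to \<open>u\<close>.\<close>

lemma cube_transposable:
  assumes x: "x \<in> cube_vertices" and y: "y \<in> cube_vertices"
  shows "transposable (vertex_space cube_vertices) x y"
proof (rule transposable_Isom)
  show "sign_change x \<in> Isom (vertex_space cube_vertices)"
    by (rule sign_change_in_Isom[OF pyritohedral_cube_vertices x])
  define u where "u = sign_change x x"
  define z where "z = sign_change x y"
  have u: "u = vector [1, 1, 1]"
    using x by (auto simp: u_def sign_change_def vec_eq_iff forall_3 cube_vertices_iff abs_if split: if_splits)
  have cube: "u \<in> cube_vertices" "z \<in> cube_vertices"
    using x y pyritohedral_cube_vertices by (auto simp: u_def z_def pyritohedral_def)
  have "transposable (vertex_space cube_vertices) u z"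
  proof (cases "z = - u")
    case True
    then show ?thesis
      using transposable_antipodal[OF finite_cube_vertices] cube_inner_nonzero cube
        pyritohedral_uminus[OF pyritohedral_cube_vertices] by metis
  next
    case False
    have coords: "(u - z)$1 \<in> {0, 2}" "(u - z)$2 \<in> {0, 2}" "(u - z)$3 \<in> {0, 2}"
      using cube(2) by (auto simp: u cube_vertices_iff abs_if split: if_splits)
    have "\<not> ((u - z)$1 = 2 \<and> (u - z)$2 = 2 \<and> (u - z)$3 = 2)"
      using False by (auto simp: u vec_eq_iff forall_3)
    then have "mirror cube_vertices (u - z)"
      using coords mirror_root[OF pyritohedral_cube_vertices cube_diagonal_mirror, of 2 "u - z"]
        mirror_root[OF pyritohedral_cube_vertices mirror_axes(1)[OF pyritohedral_cube_vertices, of 1], of 2 "u - z"]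
        mirror_root[OF pyritohedral_cube_vertices mirror_axes(1)[OF pyritohedral_cube_vertices, of 0], of 0 "u - z"]
      by auto
    then show ?thesis
      using cube by (simp add: transposable_mirror finite_cube_vertices cube_vertices_norm)
  qed
  then show "transposable (vertex_space cube_vertices) (sign_change x x) (sign_change x y)"
    by (simp add: u_def z_def)
qed (use assms in auto)

lemma cube_homogeneous:
  assumes "cube P"
  shows "point_homogeneous_polytope m P"
proof (rule homogeneous_polytope_if_transposable)
  show "similar (convex hull cube_vertices) P"
    using assms by (simp add: cube_def cube_vertices_def)
  show "cube_vertices \<subseteq> sphere 0 (sqrt 3)" by (auto simp: cube_vertices_norm)
qed (simp_all add: finite_cube_vertices cube_transposable)

section \<open>The regular icosahedron\<close>

lemma golden_ratio_square: "golden_ratio * golden_ratio = golden_ratio + 1"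
  by (simp add: golden_ratio_def field_simps)

lemma golden_ratio_gt_1: "golden_ratio > 1"
  by (simp add: golden_ratio_def)

lemma golden_ratio_inverse: "1 / golden_ratio = golden_ratio - 1"
  using golden_ratio_square golden_ratio_gt_1 by (simp add: field_simps)

definition icosahedron_vertices :: "(real^3) set" where
  "icosahedron_vertices = cyclic_points 1 golden_ratio"

lemma golden_ratio_mult_left: "golden_ratio * (golden_ratio * x) = golden_ratio * x + x"
  using golden_ratio_square by (metis distrib_right mult.assoc mult_1)

lemma icosahedron_iff: "x \<in> icosahedron_vertices \<longleftrightarrow>
    x$1 = 0 \<and> \<bar>x$2\<bar> = 1 \<and> \<bar>x$3\<bar> = golden_ratio \<or>
    \<bar>x$1\<bar> = 1 \<and> \<bar>x$2\<bar> = golden_ratio \<and> x$3 = 0 \<or>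
    \<bar>x$1\<bar> = golden_ratio \<and> x$2 = 0 \<and> \<bar>x$3\<bar> = 1"
  unfolding icosahedron_vertices_def using golden_ratio_gt_1 by (intro cyclic_points_iff) auto

lemma pyritohedral_icosahedron_vertices: "pyritohedral icosahedron_vertices"
  unfolding icosahedron_vertices_def using golden_ratio_gt_1 by (intro pyritohedral_cyclic_points) auto

text \<open>The normal is the difference of the adjacent vertices \<open>(0, 1, \<phi>)\<close> and \<open>(-1, \<phi>, 0)\<close>, up to signs: the
bisector of an edge is a plane of symmetry.  Here \<open>\<phi> - 1 = 1 / \<phi>\<close>, and the reflections are linear in \<open>\<phi>\<close>
because \<open>\<phi>\<^sup>2 = \<phi> + 1\<close>.\<close>

lemma icosahedron_mirror:
  "mirror icosahedron_vertices (vector [1, golden_ratio - 1, golden_ratio])" (is "mirror _ ?n")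
proof (rule mirror_up_to_sign)
  let ?p = golden_ratio
  let ?S = "{vector [0, 1, ?p], vector [0, 1, - ?p], vector [1, ?p, 0], vector [1, - ?p, 0],
    vector [?p, 0, 1], vector [?p, 0, -1]} :: (real^3) set"
  show "v \<in> ?S \<or> - v \<in> ?S" if "v \<in> icosahedron_vertices" for v
    using cyclic_points_up_to_sign that unfolding icosahedron_vertices_def .
  have n: "?n \<bullet> ?n = 4"
    by (simp add: inner_vec_def sum_3 algebra_simps golden_ratio_square)
  note [simp] = icosahedron_iff inner_vec_def sum_3 algebra_simps golden_ratio_square golden_ratio_mult_left
  have [simp]: "\<bar>?p\<bar> = ?p" using golden_ratio_gt_1 by simp
  show "reflection ?n v \<in> icosahedron_vertices" if "v \<in> ?S" for v
  proof -
    have "reflection ?n (vector [0, 1, ?p]) \<in> icosahedron_vertices"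
      by (rule reflection_in[OF n, of _ ?p]) simp_all
    moreover have "reflection ?n (vector [0, 1, - ?p]) \<in> icosahedron_vertices"
      by (rule reflection_in[OF n, of _ "-1"]) simp_all
    moreover have "reflection ?n (vector [1, ?p, 0]) \<in> icosahedron_vertices"
      by (rule reflection_in[OF n, of _ 1]) simp_all
    moreover have "reflection ?n (vector [1, - ?p, 0]) \<in> icosahedron_vertices"
      by (rule reflection_in[OF n, of _ 0]) simp_all
    moreover have "reflection ?n (vector [?p, 0, 1]) \<in> icosahedron_vertices"
      by (rule reflection_in[OF n, of _ ?p]) simp_all
    moreover have "reflection ?n (vector [?p, 0, -1]) \<in> icosahedron_vertices"
      by (rule reflection_in[OF n, of _ 0]) simp_all
    ultimately show ?thesis using that by blast
  qed
qed (rule pyritohedral_uminus[OF pyritohedral_icosahedron_vertices])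

lemma icosahedron_vertices_norm: "v \<in> icosahedron_vertices \<Longrightarrow> norm v = sqrt (golden_ratio + 2)"
  using cyclic_points_norm[of v 1 golden_ratio] by (simp add: icosahedron_vertices_def golden_ratio_square)

lemma finite_icosahedron_vertices: "finite icosahedron_vertices"
  using pyritohedral_icosahedron_vertices by (simp add: pyritohedral_def)

text \<open>The icosahedron has 15 mirrors, and their normals are the three axes and the orbit of
\<open>(1, \<phi> - 1, \<phi>)\<close> under sign changes and cyclic shifts.  For \<open>u = (0, 1, \<phi>)\<close> every difference \<open>u - z\<close>
is a multiple of such a normal, except when \<open>z = - u\<close>.\<close>

lemma icosahedron_transposable:
  assumes x: "x \<in> icosahedron_vertices" and y: "y \<in> icosahedron_vertices"
  shows "transposable (vertex_space icosahedron_vertices) x y"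
proof -
  let ?p = golden_ratio and ?u = "vector [0, 1, golden_ratio] :: real^3"
  note V = pyritohedral_icosahedron_vertices
  obtain h where h: "h \<in> Isom (vertex_space icosahedron_vertices)" "h x = ?u"
    using cyclic_points_transitive[OF V] x golden_ratio_gt_1
    unfolding icosahedron_vertices_def by (metis less_eq_real_def less_trans zero_less_one)
  define z where "z = h y"
  have z: "z \<in> icosahedron_vertices"
    using Isom_in_mspace[OF h(1)] y by (auto simp: z_def)
  have u: "?u \<in> icosahedron_vertices" using golden_ratio_gt_1 by (simp add: icosahedron_iff)
  have "transposable (vertex_space icosahedron_vertices) ?u z"
  proof (cases "z = - ?u")
    case True
    have "a \<bullet> ?u \<noteq> 0" if "a \<in> icosahedron_vertices" for a
      using that golden_ratio_gt_1 golden_ratio_square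
      by (auto simp: icosahedron_iff inner_vec_def sum_3 abs_eq_iff')
    then show ?thesis
      unfolding True by (intro transposable_antipodal finite_icosahedron_vertices pyritohedral_uminus[OF V])
  next
    case False
    let ?n = "?u - z"
    have "z$1 = 0 \<and> (z$2 = 1 \<or> z$2 = -1) \<and> (z$3 = ?p \<or> z$3 = - ?p) \<or>
        (z$1 = 1 \<or> z$1 = -1) \<and> (z$2 = ?p \<or> z$2 = - ?p) \<and> z$3 = 0 \<or>
        (z$1 = ?p \<or> z$1 = - ?p) \<and> z$2 = 0 \<and> (z$3 = 1 \<or> z$3 = -1)"
      using z by (auto simp: icosahedron_iff abs_if split: if_splits)
    then consider "z$1 = 0" "z$2 = 1" "z$3 = ?p" | "z$1 = 0" "z$2 = 1" "z$3 = - ?p" | "z$1 = 0" "z$2 = -1" "z$3 = ?p"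
      | "\<bar>z$1\<bar> = 1" "z$2 = ?p" "z$3 = 0" | "\<bar>z$1\<bar> = 1" "z$2 = - ?p" "z$3 = 0"
      | "\<bar>z$1\<bar> = ?p" "z$2 = 0" "z$3 = 1" | "\<bar>z$1\<bar> = ?p" "z$2 = 0" "z$3 = -1"
      using False golden_ratio_gt_1 by (auto simp: vec_eq_iff forall_3)
    \<comment> \<open>Here \<open>?n\<close> is 0, \<open>2 * \<phi>\<close> or 2 times an axis, or 1 or \<open>\<phi>\<close> times a normal from the
      orbit; for instance, \<open>(1, \<phi> + 1, \<phi>)\<close> is \<open>\<phi>\<close> times \<open>(\<phi> - 1, \<phi>, 1)\<close>.\<close>
    then have "mirror icosahedron_vertices ?n"
    proof cases
      case 1
      then show ?thesis by (intro mirror_root[OF V mirror_axes(1)[OF V, of 0], of 0]) auto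
    next
      case 2
      then show ?thesis using golden_ratio_gt_1
        by (intro mirror_root[OF V mirror_axes(1)[OF V, of 1], of "2 * ?p"]) auto
    next
      case 3
      then show ?thesis by (intro mirror_root[OF V mirror_axes(1)[OF V, of 1], of 2]) auto
    next
      case 4
      then show ?thesis using golden_ratio_gt_1 by (intro mirror_root[OF V icosahedron_mirror, of 1]) auto
    next
      case 5
      then show ?thesis using golden_ratio_gt_1
        by (intro mirror_root[OF V icosahedron_mirror, of ?p]) (auto simp: golden_ratio_square algebra_simps)
    next
      case 6
      then show ?thesis using golden_ratio_gt_1 by (intro mirror_root[OF V icosahedron_mirror, of 1]) auto
    next
      case 7
      then show ?thesis using golden_ratio_gt_1
        by (intro mirror_root[OF V icosahedron_mirror, of ?p]) (auto simp: golden_ratio_square algebra_simps)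
    qed
    then show ?thesis
      using z u by (simp add: transposable_mirror finite_icosahedron_vertices icosahedron_vertices_norm)
  qed
  then show ?thesis
    using transposable_Isom[OF h(1), of x y] x y h(2) by (simp add: z_def)
qed

lemma icosahedron_homogeneous:
  assumes "regular_icosahedron P"
  shows "point_homogeneous_polytope m P"
proof (rule homogeneous_polytope_if_transposable)
  show "similar (convex hull icosahedron_vertices) P"
    using assms by (simp add: regular_icosahedron_def icosahedron_vertices_def)
  show "icosahedron_vertices \<subseteq> sphere 0 (sqrt (golden_ratio + 2))" by (auto simp: icosahedron_vertices_norm)
qed (simp_all add: finite_icosahedron_vertices icosahedron_transposable)

section \<open>The regular dodecahedron\<close>

definition dodecahedron_vertices :: "(real^3) set" where
  "dodecahedron_vertices = cube_vertices \<union> cyclic_points (golden_ratio - 1) golden_ratio"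

lemma pyritohedral_dodecahedron_vertices: "pyritohedral dodecahedron_vertices"
  unfolding dodecahedron_vertices_def using golden_ratio_gt_1
  by (intro pyritohedral_Un pyritohedral_cyclic_points pyritohedral_cube_vertices) auto

lemma finite_dodecahedron_vertices: "finite dodecahedron_vertices"
  using pyritohedral_dodecahedron_vertices by (simp add: pyritohedral_def)

lemma dodecahedron_iff: "x \<in> dodecahedron_vertices \<longleftrightarrow>
    \<bar>x$1\<bar> = 1 \<and> \<bar>x$2\<bar> = 1 \<and> \<bar>x$3\<bar> = 1 \<or>
    x$1 = 0 \<and> \<bar>x$2\<bar> = golden_ratio - 1 \<and> \<bar>x$3\<bar> = golden_ratio \<or>
    \<bar>x$1\<bar> = golden_ratio - 1 \<and> \<bar>x$2\<bar> = golden_ratio \<and> x$3 = 0 \<or>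
    \<bar>x$1\<bar> = golden_ratio \<and> x$2 = 0 \<and> \<bar>x$3\<bar> = golden_ratio - 1"
  unfolding dodecahedron_vertices_def using golden_ratio_gt_1
  by (subst Un_iff, subst cyclic_points_iff) (auto simp: cube_vertices_iff)

lemma dodecahedron_vertices_norm:
  assumes "v \<in> dodecahedron_vertices" shows "norm v = sqrt 3"
proof -
  have "(golden_ratio - 1) * (golden_ratio - 1) + golden_ratio * golden_ratio = 3"
    by (simp add: algebra_simps golden_ratio_square)
  then show ?thesis
    using assms cube_vertices_norm[of v] cyclic_points_norm[of v "golden_ratio - 1" golden_ratio]
    unfolding dodecahedron_vertices_def by auto
qed

text \<open>Again the bisector of an edge: up to scale, signs and a cyclic shift, the normal is the difference
of the adjacent vertices \<open>(1, 1, 1)\<close> and \<open>(0, \<phi> - 1, \<phi>)\<close>.\<close>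

lemma dodecahedron_mirror:
  "mirror dodecahedron_vertices (vector [golden_ratio - 1, 1, golden_ratio])" (is "mirror _ ?n")
proof (rule mirror_up_to_sign)
  let ?p = golden_ratio
  let ?q = "golden_ratio - 1"
  let ?C = "{vector [1, 1, 1], vector [1, 1, -1], vector [1, -1, 1], vector [-1, 1, 1]} :: (real^3) set"
  let ?D = "{vector [0, ?q, ?p], vector [0, ?q, - ?p], vector [?q, ?p, 0], vector [?q, - ?p, 0],
    vector [?p, 0, ?q], vector [?p, 0, - ?q]} :: (real^3) set"
  have "v \<in> ?C \<or> - v \<in> ?C" if "v \<in> cube_vertices" for v
  proof -
    from that obtain a b c where v: "v = vector [a, b, c]" "a = -1 \<or> a = 1" "b = -1 \<or> b = 1" "c = -1 \<or> c = 1"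
      by (rule cube_verticesE)
    show ?thesis unfolding v(1) using v(2-4) by (elim disjE; simp add: vec_eq_iff forall_3)
  qed
  then show "v \<in> ?C \<union> ?D \<or> - v \<in> ?C \<union> ?D" if "v \<in> dodecahedron_vertices" for v
    using that cyclic_points_up_to_sign[of v ?q ?p] unfolding dodecahedron_vertices_def Un_iff by metis
  have n: "?n \<bullet> ?n = 4"
    by (simp add: inner_vec_def sum_3 algebra_simps golden_ratio_square)
  note [simp] = dodecahedron_iff inner_vec_def sum_3 algebra_simps golden_ratio_square golden_ratio_mult_left
  have [simp]: "\<bar>?p\<bar> = ?p" "\<bar>1 - ?p\<bar> = ?p - 1" "\<bar>?p - 1\<bar> = ?p - 1" using golden_ratio_gt_1 by simp_all
  show "reflection ?n v \<in> dodecahedron_vertices" if "v \<in> ?C \<union> ?D" for v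
  proof -
    have "reflection ?n (vector [1, 1, 1]) \<in> dodecahedron_vertices"
      by (rule reflection_in[OF n, of _ ?p]) simp_all
    moreover have "reflection ?n (vector [1, 1, -1]) \<in> dodecahedron_vertices"
      by (rule reflection_in[OF n, of _ 0]) simp_all
    moreover have "reflection ?n (vector [1, -1, 1]) \<in> dodecahedron_vertices"
      by (rule reflection_in[OF n, of _ ?q]) simp_all
    moreover have "reflection ?n (vector [-1, 1, 1]) \<in> dodecahedron_vertices"
      by (rule reflection_in[OF n, of _ 1]) simp_all
    moreover have "reflection ?n (vector [0, ?q, ?p]) \<in> dodecahedron_vertices"
      by (rule reflection_in[OF n, of _ ?p]) simp_all
    moreover have "reflection ?n (vector [0, ?q, - ?p]) \<in> dodecahedron_vertices"
      by (rule reflection_in[OF n, of _ "-1"]) simp_all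
    moreover have "reflection ?n (vector [?q, ?p, 0]) \<in> dodecahedron_vertices"
      by (rule reflection_in[OF n, of _ 1]) simp_all
    moreover have "reflection ?n (vector [?q, - ?p, 0]) \<in> dodecahedron_vertices"
      by (rule reflection_in[OF n, of _ "1 - ?p"]) simp_all
    moreover have "reflection ?n (vector [?p, 0, ?q]) \<in> dodecahedron_vertices"
      by (rule reflection_in[OF n, of _ 1]) simp_all
    moreover have "reflection ?n (vector [?p, 0, - ?q]) \<in> dodecahedron_vertices"
      by (rule reflection_in[OF n, of _ 0]) simp_all
    ultimately show ?thesis using that by blast
  qed
qed (rule pyritohedral_uminus[OF pyritohedral_dodecahedron_vertices])

lemma golden_ratio_lt_2: "golden_ratio < 2"
proof -
  have "sqrt 5 < sqrt 9" by (simp only: real_sqrt_less_iff)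
  then show ?thesis by (simp add: golden_ratio_def)
qed

text \<open>Sign changes and cyclic shifts have two orbits, the 8 vertices of the inscribed cube and the other 12.
A reflection takes \<open>(0, \<phi> - 1, \<phi>)\<close> to \<open>(-1, -1, -1)\<close> and joins them.\<close>

lemma dodecahedron_transitive:
  assumes "x \<in> dodecahedron_vertices"
  shows "\<exists>f\<in>Isom (vertex_space dodecahedron_vertices). f x = vector [1, 1, 1]"
proof (cases "x \<in> cube_vertices")
  case True
  then have "sign_change x x = vector [1, 1, 1]"
    by (auto simp: sign_change_def vec_eq_iff forall_3 cube_vertices_iff abs_if split: if_splits)
  then show ?thesis using sign_change_in_Isom[OF pyritohedral_dodecahedron_vertices True] by blast
next
  case False
  let ?p = golden_ratio
  let ?n = "vector [?p - 1, 1, ?p] :: real^3" and ?s = "vector [-1, -1, -1] :: real^3"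
  obtain h where h: "h \<in> Isom (vertex_space dodecahedron_vertices)" "h x = vector [0, ?p - 1, ?p]"
    using cyclic_points_transitive[OF pyritohedral_dodecahedron_vertices, of "?p - 1" ?p x] golden_ratio_gt_1 assms False
    by (auto simp: dodecahedron_vertices_def)
  have "?s \<in> cube_vertices" by (simp add: cube_vertices_iff)
  then have "sign_change ?s \<circ> (reflection ?n \<circ> h) \<in> Isom (vertex_space dodecahedron_vertices)"
    by (intro comp_in_Isom h(1) mirror_in_Isom finite_dodecahedron_vertices dodecahedron_mirror
        sign_change_in_Isom pyritohedral_dodecahedron_vertices)
  moreover have "(sign_change ?s \<circ> (reflection ?n \<circ> h)) x = vector [1, 1, 1]"
    by (simp add: h(2) reflection_def sign_change_def vec3_simps algebra_simps golden_ratio_square)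
  ultimately show ?thesis by blast
qed

text \<open>Seen along the axis through \<open>(1, 1, 1)\<close> the vertices lie in six layers, of 1, 3, 6, 6, 3 and 1
points.  This set contains one vertex of each layer.\<close>

definition dodecahedron_layers :: "(real^3) set" where
  "dodecahedron_layers = {vector [1, 1, 1], vector [-1, -1, -1], vector [1, 1, -1], vector [-1, -1, 1],
     vector [0, golden_ratio - 1, golden_ratio], vector [0, 1 - golden_ratio, - golden_ratio]}"

text \<open>The heights of the six layers are \<open>\<plusminus>3\<close>, \<open>\<plusminus>(2 * \<phi> - 1) = \<plusminus>sqrt 5\<close> and \<open>\<plusminus>1\<close>.\<close>

lemma dodecahedron_layers_heights:
  assumes "x \<in> dodecahedron_layers" "y \<in> dodecahedron_layers" "vector [1, 1, 1] \<bullet> x = vector [1, 1, 1] \<bullet> y"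
  shows "x = y"
  using assms golden_ratio_gt_1 golden_ratio_lt_2
  by (auto simp: dodecahedron_layers_def inner_vec_def sum_3)

text \<open>The cyclic shift fixes \<open>(1, 1, 1)\<close> and has one orbit on the layers of three points, but two on
each layer of six: one in the inscribed cube and one outside.  The mirror with normal
\<open>(\<phi> - 1, 1, - \<phi>)\<close> contains \<open>(1, 1, 1)\<close> and exchanges a point of one with a point of the other.\<close>

lemma dodecahedron_stabilizer_orbits:
  assumes x: "x \<in> dodecahedron_vertices"
  obtains f where "f \<in> Isom (vertex_space dodecahedron_vertices)" "f (vector [1, 1, 1]) = vector [1, 1, 1]"
    "f x \<in> dodecahedron_layers"
proof -
  let ?p = golden_ratio and ?o = "vector [1, 1, 1] :: real^3"
  let ?n = "vector [?p - 1, 1, - ?p] :: real^3"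
  let ?I = "Isom (vertex_space dodecahedron_vertices)"
  note V = pyritohedral_dodecahedron_vertices
  define G where "G = {f \<in> ?I. f ?o = ?o}"
  have comp: "g \<circ> f \<in> G" if "f \<in> G" "g \<in> G" for f g
    using that comp_in_Isom by (auto simp: G_def)
  have id: "(\<lambda>x. x) \<in> G" using id_in_Isom by (auto simp: G_def)
  have c: "cyclic_shift \<in> G"
    using cyclic_shift_in_Isom[OF V] by (simp add: G_def) (simp add: cyclic_shift_def)
  have "mirror dodecahedron_vertices ?n"
    by (rule mirror_root[OF V dodecahedron_mirror, of 1]) auto
  then have r: "reflection ?n \<in> G"
    using mirror_in_Isom[OF finite_dodecahedron_vertices]
    by (simp add: G_def) (simp add: reflection_def vec3_simps)
  have "\<exists>g\<in>G. g x \<in> dodecahedron_layers \<or> g x = vector [0, 1 - ?p, ?p] \<or> g x = vector [0, ?p - 1, - ?p]"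
  proof (cases "x \<in> cube_vertices")
    case True
    from True obtain a b c where v: "x = vector [a, b, c]" "a = -1 \<or> a = 1" "b = -1 \<or> b = 1" "c = -1 \<or> c = 1"
      by (rule cube_verticesE)
    have "\<exists>g\<in>{\<lambda>x. x, cyclic_shift, cyclic_shift \<circ> cyclic_shift}.
        g x \<in> {vector [1, 1, 1], vector [-1, -1, -1], vector [1, 1, -1], vector [-1, -1, 1]}" (is "\<exists>g\<in>?C. g x \<in> ?T")
      unfolding v(1) using v(2-4) by (elim disjE; simp add: vec_eq_iff forall_3 cyclic_shift_def)
    then obtain g where "g \<in> ?C" "g x \<in> ?T" ..
    moreover have "?T \<subseteq> dodecahedron_layers" by (simp add: dodecahedron_layers_def)
    moreover have "?C \<subseteq> G" using id c comp[OF c c] by simp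
    ultimately show ?thesis by (meson subsetD)
  next
    case False
    then have "x \<in> cyclic_points (?p - 1) ?p" using x by (simp add: dodecahedron_vertices_def)
    then obtain g where "g \<in> {\<lambda>x. x, cyclic_shift, cyclic_shift \<circ> cyclic_shift}"
        and gx: "(g x)$1 = 0" "\<bar>(g x)$2\<bar> = ?p - 1" "\<bar>(g x)$3\<bar> = ?p"
      using cyclic_points_shift[of "?p - 1" ?p x] golden_ratio_gt_1 by auto
    then have "g \<in> G" using id c comp[OF c c] by blast
    moreover have "(g x)$2 = ?p - 1 \<or> (g x)$2 = 1 - ?p" "(g x)$3 = ?p \<or> (g x)$3 = - ?p"
      using gx by (auto simp: abs_eq_iff')
    moreover have "g x = vector [0, (g x)$2, (g x)$3]"
      using gx(1) by (simp add: vec_eq_iff forall_3)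
    ultimately have "g \<in> G \<and> (g x \<in> dodecahedron_layers \<or> g x = vector [0, 1 - ?p, ?p] \<or> g x = vector [0, ?p - 1, - ?p])"
      unfolding dodecahedron_layers_def by (elim disjE) simp_all
    then show ?thesis by blast
  qed
  then obtain g where g: "g \<in> G"
      "g x \<in> dodecahedron_layers \<or> g x = vector [0, 1 - ?p, ?p] \<or> g x = vector [0, ?p - 1, - ?p]"
    by blast
  have r1: "reflection ?n (vector [0, 1 - ?p, ?p]) = vector [1, 1, -1]"
    and r2: "reflection ?n (vector [0, ?p - 1, - ?p]) = vector [-1, -1, 1]"
    by (simp_all add: reflection_def vec3_simps algebra_simps golden_ratio_square)
  from g(2) have "g x \<in> dodecahedron_layers \<or> (reflection ?n \<circ> g) x \<in> dodecahedron_layers"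
    by (elim disjE) (simp_all add: r1 r2 dodecahedron_layers_def)
  then obtain f where "f \<in> G" "f x \<in> dodecahedron_layers"
    using g(1) comp[OF g(1) r] by metis
  then show thesis using that unfolding G_def by blast
qed

lemma inner_eq_if_dist_eq:
  assumes "norm x = norm y" "norm a = norm b" "dist a x = dist b y"
  shows "a \<bullet> x = b \<bullet> y"
proof -
  have "(a - x) \<bullet> (a - x) = (b - y) \<bullet> (b - y)" using assms(3) by (simp add: dist_norm norm_eq)
  moreover have "x \<bullet> x = y \<bullet> y" "a \<bullet> a = b \<bullet> b" using assms by (simp_all add: norm_eq)
  ultimately show ?thesis by (simp add: inner_diff_left inner_diff_right inner_commute)
qed

lemma dodecahedron_two_point_homogeneous: "point_homogeneous 2 (vertex_space dodecahedron_vertices)"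
proof (rule two_point_homogeneous_if_stabilizer_transitive)
  let ?o = "vector [1, 1, 1] :: real^3" and ?I = "Isom (vertex_space dodecahedron_vertices)"
  show o: "?o \<in> mspace (vertex_space dodecahedron_vertices)"
    by (simp add: dodecahedron_iff)
  show "\<exists>f\<in>?I. f x = ?o" if "x \<in> mspace (vertex_space dodecahedron_vertices)" for x
    using dodecahedron_transitive that by simp
  show "\<exists>f\<in>?I. f ?o = ?o \<and> f x = y"
    if x: "x \<in> mspace (vertex_space dodecahedron_vertices)" and y: "y \<in> mspace (vertex_space dodecahedron_vertices)"
      and xy: "mdist (vertex_space dodecahedron_vertices) ?o x = mdist (vertex_space dodecahedron_vertices) ?o y" for x y
  proof -
    obtain f where f: "f \<in> ?I" "f ?o = ?o" "f x \<in> dodecahedron_layers"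
      using dodecahedron_stabilizer_orbits x by auto
    obtain g where g: "g \<in> ?I" "g ?o = ?o" "g y \<in> dodecahedron_layers"
      using dodecahedron_stabilizer_orbits y by auto
    have V: "f x \<in> dodecahedron_vertices" "g y \<in> dodecahedron_vertices"
      using Isom_in_mspace[OF f(1) x] Isom_in_mspace[OF g(1) y] by auto
    have "dist ?o (f x) = dist ?o (g y)"
      using mdist_Isom[OF f(1) o x] mdist_Isom[OF g(1) o y] f(2) g(2) xy by simp
    then have "?o \<bullet> f x = ?o \<bullet> g y"
      using V by (intro inner_eq_if_dist_eq) (simp_all add: dodecahedron_vertices_norm)
    then have eq: "f x = g y" using dodecahedron_layers_heights f(3) g(3) by blast
    obtain k where k: "k \<in> ?I" "\<And>z. z \<in> mspace (vertex_space dodecahedron_vertices) \<Longrightarrow> k (g z) = z"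
      using Isom_inverse[OF g(1)] by metis
    have "k \<circ> f \<in> ?I" by (rule comp_in_Isom[OF f(1) k(1)])
    moreover have "(k \<circ> f) ?o = ?o" "(k \<circ> f) x = y"
      using k(2)[OF o] k(2)[OF y] f(2) g(2) eq by simp_all
    ultimately show ?thesis by blast
  qed
qed

text \<open>An isometry of the vertices preserves inner products, as these lie on a sphere.  If it fixes
\<open>x = (1, 1, 1)\<close> and exchanges \<open>y = (-1, 1, 1)\<close> and \<open>z = (1, -1, 1)\<close>, it exchanges \<open>x - y\<close> and \<open>x - z\<close>,
hence the first two coordinates of every vertex.  But \<open>(0, \<phi> - 1, \<phi>)\<close> is a vertex,
while \<open>(\<phi> - 1, 0, \<phi>)\<close> is not.\<close>

lemma dodecahedron_not_three_point_homogeneous: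
  "\<not> point_homogeneous 3 (vertex_space dodecahedron_vertices)"
proof
  assume hom: "point_homogeneous 3 (vertex_space dodecahedron_vertices)"
  let ?p = golden_ratio and ?V = dodecahedron_vertices
  define x y z w :: "real^3" where "x = vector [1, 1, 1]" and "y = vector [-1, 1, 1]"
    and "z = vector [1, -1, 1]" and "w = vector [0, ?p - 1, ?p]"
  have V: "x \<in> ?V" "y \<in> ?V" "z \<in> ?V" "w \<in> ?V"
    using golden_ratio_gt_1 by (simp_all add: x_def y_def z_def w_def dodecahedron_iff)
  have "dist x y = dist x z"
    by (simp add: x_def y_def z_def dist_norm norm_eq_sqrt_inner inner_vec_def sum_3)
  define A where "A i = (if i = 1 then x else if i = 2 then y else z)" for i :: nat
  define B where "B i = (if i = 1 then x else if i = 2 then z else y)" for i :: nat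
  have three: "{1..3::nat} = {1, 2, 3}" by auto
  have "\<exists>f\<in>Isom (vertex_space ?V). \<forall>i\<in>{1..3}. f (A i) = B i"
    by (rule hom[unfolded point_homogeneous_def, rule_format])
      (use V \<open>dist x y = dist x z\<close> in \<open>auto simp: three A_def B_def dist_commute\<close>)
  then obtain f where f: "f \<in> Isom (vertex_space ?V)" "f x = x" "f y = z" "f z = y"
    unfolding three by (auto simp: A_def B_def)
  have fw: "f w \<in> ?V" using Isom_in_mspace[OF f(1), of w] V by simp
  have inner: "f w \<bullet> f v = w \<bullet> v" if "v \<in> ?V" for v
    using mdist_Isom[OF f(1), of w v] Isom_in_mspace[OF f(1), of v] fw V(4) that
    by (intro inner_eq_if_dist_eq) (simp_all add: dodecahedron_vertices_norm)
  have "(f w)$1 = ?p - 1" "(f w)$2 = 0" "(f w)$3 = ?p"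
    using inner[OF V(1)] inner[OF V(2)] inner[OF V(3)] f(2-4)
    by (simp_all add: x_def y_def z_def w_def inner_vec_def sum_3)
  then show False
    using fw golden_ratio_gt_1 by (simp add: dodecahedron_iff)
qed

lemma dodecahedron_homogeneous_iff:
  assumes "regular_dodecahedron P"
  shows "point_homogeneous_polytope m P \<longleftrightarrow> point_homogeneous m (vertex_space dodecahedron_vertices)"
proof (rule point_homogeneous_polytope_similar)
  show "similar (convex hull dodecahedron_vertices) P"
    using assms
    by (simp add: regular_dodecahedron_def dodecahedron_vertices_def cube_vertices_def golden_ratio_inverse)
  show "dodecahedron_vertices \<subseteq> sphere 0 (sqrt 3)" by (auto simp: dodecahedron_vertices_norm)
qed (rule finite_dodecahedron_vertices)

section \<open>The five regular solids\<close>

theorem theorem1: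
  shows "(\<forall>P m. regular_tetrahedron P \<and> m \<ge> 1 \<longrightarrow> point_homogeneous_polytope m P) \<and>
         (\<forall>P m. cube P \<and> m \<ge> 1 \<longrightarrow> point_homogeneous_polytope m P) \<and>
         (\<forall>P m. regular_octahedron P \<and> m \<ge> 1 \<longrightarrow> point_homogeneous_polytope m P) \<and>
         (\<forall>P m. regular_icosahedron P \<and> m \<ge> 1 \<longrightarrow> point_homogeneous_polytope m P) \<and>
         (\<forall>P. regular_dodecahedron P \<longrightarrow>
            point_homogeneous_polytope 2 P \<and> \<not> point_homogeneous_polytope 3 P)"
  by (simp add: tetrahedron_homogeneous cube_homogeneous octahedron_homogeneous icosahedron_homogeneous
      dodecahedron_homogeneous_iff dodecahedron_two_point_homogeneous dodecahedron_not_three_point_homogeneous)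

end
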